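(* Let $G$ be a finite simple graph and let $b\ge 1$ be a real number. Then every complex root of the polynomial $z\mapsto Z_{L(G)}(z,b)$ is real and negative, where $L(G)$ is the line graph of $G$ and $Z_{L(G)}(z,b)$ is the partition function of the Ising model on $L(G)$.
   Context: For a finite simple graph $H=(V,E)$ and $z,b\in\mathbb{C}$, the partition function of the Ising model is $Z_H(z,b)=\sum_{U\subseteq V} z^{|U|}\, b^{|\delta(U)|}$, where $\delta(U)$ denotes the set of edges of $H$ with one endpoint in $U$ and one endpoint in $V\setminus U$. The line graph $L(G)$ of a graph $G$ is the simple graph whose vertices are the edges of $G$, two distinct edges of $G$ being adjacent in $L(G)$ if they share a common vertex. *)

theory Defs
  imports Complex_Main
begin

record 'a sgraph =
  sg_verts :: "'a set"
  sg_edges :: "'a set set"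

text \<open>Edges are two-element sets of vertices, which excludes loops and parallel edges.
  The graph without vertices is allowed.\<close>

locale finite_simple_graph =
  fixes G :: "'a sgraph"
  assumes finite_verts: "finite (sg_verts G)"
    and edge_subset: "e \<in> sg_edges G \<Longrightarrow> e \<subseteq> sg_verts G"
    and edge_card: "e \<in> sg_edges G \<Longrightarrow> card e = 2"

definition line_graph :: "'a sgraph \<Rightarrow> 'a set sgraph" where
  "line_graph G =
    \<lparr> sg_verts = sg_edges G,
      sg_edges = {{e, f} | e f. e \<in> sg_edges G \<and> f \<in> sg_edges G \<and> e \<noteq> f \<and> e \<inter> f \<noteq> {}} \<rparr>"

definition edge_boundary :: "'a sgraph \<Rightarrow> 'a set \<Rightarrow> 'a set set" where
  "edge_boundary H U =
    {e \<in> sg_edges H. \<exists>u v. e = {u, v} \<and> u \<in> U \<and> v \<in> sg_verts H - U}"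

definition ising_Z :: "'a sgraph \<Rightarrow> complex \<Rightarrow> complex \<Rightarrow> complex" where
  "ising_Z H z b = (\<Sum>U\<in>Pow (sg_verts H). z ^ card U * b ^ card (edge_boundary H U))"

lemma finite_simple_graph_line_graph:
  assumes "finite_simple_graph G"
  shows "finite_simple_graph (line_graph G)"
proof -
  interpret finite_simple_graph G by fact
  have "sg_edges G \<subseteq> Pow (sg_verts G)"
    using edge_subset by blast
  then have "finite (sg_edges G)"
    using finite_verts by (simp add: finite_subset)
  then show ?thesis
    by unfold_locales (auto simp: line_graph_def card_2_iff)
qed

end

theory Submission
  imports Defs "HOL-Computational_Algebra.Fundamental_Theorem_Algebra" "HOL-Library.Disjoint_Sets"
begin

text \<open>Two distinct edges of a simple graph share at most one vertex.  Hence for a set \<open>F\<close> of edges,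
  the boundary of \<open>F\<close> in the line graph has \<open>\<Sum>v. k\<^sub>v * (d\<^sub>v - k\<^sub>v)\<close> elements, where \<open>d\<^sub>v\<close> is the degree
  of \<open>v\<close> and \<open>k\<^sub>v\<close> the number of edges of \<open>F\<close> at \<open>v\<close>, and the partition function is
  \<open>\<Sum>F. z ^ card F * (\<Prod>v. b ^ (k\<^sub>v * (d\<^sub>v - k\<^sub>v)))\<close>.  In other words, the line graph is assembled from
  the complete graphs formed by the edges at each vertex, glued by the condition that the two
  halves of an edge are both chosen or both left out.

  Give each half-edge its own variable.  The local factor at a vertex of degree \<open>d\<close> is then the
  Ising polynomial of the complete graph on \<open>d\<close> vertices,
  \<open>\<Sum>S. b ^ (card S * (d - card S)) * (\<Prod>h\<in>S. s h)\<close>.  If all its variables are equal, this is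
  \<open>\<Sum>k\<le>d. (d choose k) * b ^ (- k\<^sup>2) * (b ^ d * x) ^ k\<close>.  For \<open>b \<ge> 1\<close> the factors \<open>b ^ (- k\<^sup>2)\<close> are
  limits of \<open>(1 - c * k\<^sup>2 / m) ^ m\<close> with \<open>c = ln b\<close>, and multiplying the coefficients of a polynomial
  with negative real roots by \<open>1 \<plusminus> s * k\<close> for small \<open>s\<close> keeps its roots negative and real.  So the
  polynomial with equal variables has no zero off the negative reals
  (\<open>gaussian_binomial_nonzero\<close>).  By the theorem of Grace, Walsh and Szego
  (\<open>grace_walsh_szego_right_half_plane\<close>) the local factor does not vanish when its variables lie in a
  closed half-plane \<open>{t * s | s. 0 \<le> Re s}\<close> with \<open>0 < Re t\<close>, since this half-plane contains no
  negative real.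

  Gluing the two halves of an edge turns \<open>A + B * x + C * y + D * x * y\<close> into \<open>A + z * D\<close>.  With
  \<open>z = t\<^sup>2\<close> this preserves nonvanishing on the half-plane: if \<open>A + t\<^sup>2 * D = 0\<close>, then the two roots
  \<open>s\<close> of \<open>A + (B + C) * t * s + D * t\<^sup>2 * s\<^sup>2\<close> have product \<open>-1\<close>, and one of them has nonnegative real part
  (\<open>nonvanishing_on_contract\<close>).  A nonzero \<open>z\<close> that is not a negative real has a square root \<open>t\<close> with
  \<open>0 < Re t\<close>, so gluing all edges shows that the partition function is not zero at \<open>z\<close>.\<close>

section \<open>Multipliers preserving negative real roots\<close>

text \<open>Factoring over \<open>\<complex>\<close> gives the logarithmic derivative as a sum over the roots with multiplicity.
  Every statement below about the location of roots is read off from this sum.\<close>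

lemma poly_roots_and_log_derivative:
  fixes p :: "complex poly"
  assumes "p \<noteq> 0"
  obtains A where "size A = degree p" and "\<And>a. a \<in># A \<longleftrightarrow> poly p a = 0"
    and "\<And>x. poly p x = lead_coeff p * (\<Prod>a\<in>#A. x - a)"
    and "\<And>x. poly p x \<noteq> 0 \<Longrightarrow> poly (pderiv p) x = poly p x * (\<Sum>a\<in>#A. 1 / (x - a))"
proof -
  obtain A where A: "size A = degree p" "p = smult (lead_coeff p) (\<Prod>a\<in>#A. [:-a, 1:])"
    using alg_closed_imp_factorization[OF assms] by blast
  have prod: "poly (\<Prod>a\<in>#B. [:-a, 1:]) x = (\<Prod>a\<in>#B. x - a)" for x and B :: "complex multiset"
    by (induction B) (auto simp: left_diff_distrib)
  have p: "poly p x = lead_coeff p * (\<Prod>a\<in>#A. x - a)" for x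
    by (subst A(2)) (simp add: prod)
  have roots: "a \<in># A \<longleftrightarrow> poly p a = 0" for a
    using assms by (auto simp: p)
  have deriv: "poly (pderiv (\<Prod>a\<in>#B. [:-a, 1:])) x = (\<Prod>a\<in>#B. x - a) * (\<Sum>a\<in>#B. 1 / (x - a))"
    if "x \<notin># B" for x and B :: "complex multiset"
    using that
  proof (induction B)
    case (add b B)
    then have "x - b \<noteq> 0" by auto
    have mult: "poly (pderiv ([:-b, 1:] * q)) x = poly q x + (x - b) * poly (pderiv q) x" for q
      by (simp add: pderiv_mult pderiv_pCons del: mult_pCons_left)
    then show ?case
      using add by (simp add: mult prod field_simps del: mult_pCons_left)
  qed auto
  have "poly (pderiv p) x = poly p x * (\<Sum>a\<in>#A. 1 / (x - a))" if "poly p x \<noteq> 0" for x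
  proof -
    have "poly (pderiv p) x = lead_coeff p * poly (pderiv (\<Prod>a\<in>#A. [:-a, 1:])) x"
      by (subst A(2)) (simp add: pderiv_smult)
    then show ?thesis
      using deriv[of x A] roots[of x] that by (simp add: p)
  qed
  then show ?thesis
    using that A(1) roots p by blast
qed

text \<open>With binomial weights, dilation of the coefficients and polarisation become operations on the
  sequence \<open>u\<close> alone.  The degree may be smaller than \<open>d\<close>, which amounts to a root at infinity.\<close>

definition binomial_poly :: "nat \<Rightarrow> (nat \<Rightarrow> complex) \<Rightarrow> complex poly" where
  "binomial_poly d u = (\<Sum>k\<le>d. monom (of_nat (d choose k) * u k) k)"

lemma coeff_binomial_poly: "coeff (binomial_poly d u) k = of_nat (d choose k) * u k"
  by (simp add: binomial_poly_def coeff_sum binomial_eq_0)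

lemma poly_binomial_poly:
  "poly (binomial_poly d u) x = (\<Sum>k\<le>d. of_nat (d choose k) * u k * x ^ k)"
  by (simp add: binomial_poly_def poly_sum poly_monom)

lemma degree_binomial_poly_le: "degree (binomial_poly d u) \<le> d"
  by (rule degree_le) (simp add: coeff_binomial_poly binomial_eq_0)

definition neg_real_rooted :: "complex poly \<Rightarrow> bool" where
  "neg_real_rooted p \<longleftrightarrow> p \<noteq> 0 \<and> (\<forall>z. poly p z = 0 \<longrightarrow> z \<in> \<real> \<and> Re z < 0)"

text \<open>At a root \<open>z\<close> of the new polynomial that is not a root of \<open>p\<close>, the logarithmic derivative gives
  \<open>1 + s * (\<Sum>a. z / (z - a)) = 0\<close>.  Since each \<open>a\<close> is a negative real, the imaginary part of
  every \<open>z / (z - a)\<close> has the sign of \<open>Im z\<close>, so \<open>z\<close> is real; and for \<open>z \<ge> 0\<close> every summand lies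
  in \<open>[0, 1]\<close>, so the sum is at most the degree and the left-hand side is positive.\<close>

lemma neg_real_rooted_add_x_pderiv:
  assumes p: "neg_real_rooted p" and s: "- 1 < s * real (degree p)"
  shows "neg_real_rooted (p + smult (of_real s) ([:0, 1:] * pderiv p))" (is "neg_real_rooted ?q")
proof -
  have "p \<noteq> 0"
    using p by (simp add: neg_real_rooted_def)
  then obtain A where A: "size A = degree p" "\<And>a. a \<in># A \<longleftrightarrow> poly p a = 0"
    "\<And>x. poly p x \<noteq> 0 \<Longrightarrow> poly (pderiv p) x = poly p x * (\<Sum>a\<in>#A. 1 / (x - a))"
    using poly_roots_and_log_derivative by metis
  have neg: "Im a = 0 \<and> Re a < 0" if "a \<in># A" for a
    using that A(2) p by (auto simp: neg_real_rooted_def complex_is_Real_iff)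
  have root: "z \<in> \<real> \<and> Re z < 0" if z: "poly ?q z = 0" for z
  proof (cases "poly p z = 0")
    case True
    then show ?thesis using p by (simp add: neg_real_rooted_def)
  next
    case False
    define T where "T B = (\<Sum>a\<in>#B. z / (z - a))" for B
    have "poly ?q z = poly p z * (1 + of_real s * T A)"
      by (simp add: A(3)[OF False] T_def sum_mset_distrib_left algebra_simps)
    then have eq: "1 + of_real s * T A = 0"
      using z False by simp
    have "Im z = 0"
    proof (rule ccontr)
      assume Im: "Im z \<noteq> 0"
      have bound: "0 < Im z * Im (z / (z - a))" if "Im a = 0 \<and> Re a < 0" for a
      proof -
        have "Im z * Im (z / (z - a)) = Im z * (Im z * Re (z - a) - Re z * Im (z - a)) / (cmod (z - a))\<^sup>2"
          by (simp add: Im_divide cmod_power2)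
        also have "Im z * (Im z * Re (z - a) - Re z * Im (z - a)) = (Im z)\<^sup>2 * (- Re a)"
          using that by (simp add: power2_eq_square algebra_simps)
        finally have "Im z * Im (z / (z - a)) = (Im z)\<^sup>2 * (- Re a) / (cmod (z - a))\<^sup>2" .
        moreover have "z - a \<noteq> 0"
          using that Im by auto
        ultimately show ?thesis
          using that Im by (auto intro!: divide_neg_pos mult_pos_neg)
      qed
      have pos: "B \<noteq> {#} \<Longrightarrow> (\<forall>a\<in>#B. Im a = 0 \<and> Re a < 0) \<Longrightarrow> 0 < Im z * Im (T B)" for B
      proof (induction B)
        case (add b B)
        then show ?case
          using bound[of b] by (cases "B = {#}") (auto simp: T_def distrib_left)
      qed auto
      have "A \<noteq> {#}"
        using eq by (auto simp: T_def)
      then have "0 < Im z * Im (T A)"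
        using neg by (intro pos) auto
      then have "Im (T A) \<noteq> 0"
        by auto
      moreover have "s \<noteq> 0"
        using eq by auto
      ultimately show False
        using arg_cong[OF eq, of Im] by simp
    qed
    moreover have "Re z < 0"
    proof (rule ccontr)
      assume "\<not> Re z < 0"
      then have z0: "z = of_real (Re z)" "0 \<le> Re z"
        using \<open>Im z = 0\<close> by (auto simp: complex_eq_iff)
      have bound: "0 \<le> Re (z / (z - a)) \<and> Re (z / (z - a)) \<le> 1" if "Im a = 0 \<and> Re a < 0" for a
      proof -
        have "a = of_real (Re a)"
          using that by (simp add: complex_eq_iff)
        then have "z / (z - a) = of_real (Re z / (Re z - Re a))"
          using z0(1) by (metis of_real_diff of_real_divide)
        then have eq: "Re (z / (z - a)) = Re z / (Re z - Re a)"
          by (metis Re_complex_of_real)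
        show ?thesis
          unfolding eq using that z0(2) by (simp add: divide_simps)
      qed
      have range: "(\<forall>a\<in>#B. Im a = 0 \<and> Re a < 0) \<Longrightarrow> 0 \<le> Re (T B) \<and> Re (T B) \<le> size B" for B
      proof (induction B)
        case (add b B)
        then show ?case
          using bound[of b] by (auto simp: T_def)
      qed (auto simp: T_def)
      have "\<forall>a\<in>#A. Im a = 0 \<and> Re a < 0"
        using neg by blast
      then have T: "0 \<le> Re (T A)" "Re (T A) \<le> degree p"
        using range[of A] A(1) by auto
      have "- 1 < s * Re (T A)"
      proof (cases "0 \<le> s")
        case True
        then show ?thesis using T(1) by (smt (verit) mult_nonneg_nonneg)
      next
        case False
        then show ?thesis using T(2) s by (smt (verit) mult_left_mono_neg)
      qed
      then show False
        using arg_cong[OF eq, of Re] by simp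
    qed
    ultimately show ?thesis
      by (simp add: complex_is_Real_iff)
  qed
  have "?q \<noteq> 0"
  proof
    assume "?q = 0"
    then have "poly ?q 0 = 0"
      by (simp only: poly_0)
    from root[OF this] show False
      by simp
  qed
  then show ?thesis
    using root by (simp add: neg_real_rooted_def)
qed

text \<open>One factor \<open>1 - (s * k)\<^sup>2\<close> is the product of the multipliers \<open>1 + s * k\<close> and \<open>1 - s * k\<close>, each of
  which comes from adding \<open>\<plusminus> s * x * p'\<close> to \<open>p\<close>.\<close>

lemma neg_real_rooted_binomial_poly_multiplier:
  assumes p: "neg_real_rooted (binomial_poly d u)" and s: "\<bar>s\<bar> * real d < 1"
  shows "neg_real_rooted (binomial_poly d (\<lambda>k. (1 - of_real ((s * real k)\<^sup>2)) ^ m * u k))"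
proof (induction m)
  case 0
  then show ?case using p by simp
next
  case (Suc m)
  have step: "neg_real_rooted (binomial_poly d (\<lambda>k. (1 + of_real (r * real k)) * w k))"
    if "neg_real_rooted (binomial_poly d w)" and r: "\<bar>r\<bar> = \<bar>s\<bar>" for r w
  proof -
    let ?p = "binomial_poly d w"
    have "\<bar>r * real (degree ?p)\<bar> \<le> \<bar>s\<bar> * real d"
      using degree_binomial_poly_le[of d w] r by (simp add: abs_mult mult_left_mono)
    then have "neg_real_rooted (?p + smult (of_real r) ([:0, 1:] * pderiv ?p))"
      using s that by (intro neg_real_rooted_add_x_pderiv) auto
    also have "?p + smult (of_real r) ([:0, 1:] * pderiv ?p)
        = binomial_poly d (\<lambda>k. (1 + of_real (r * real k)) * w k)"
    proof (rule poly_eqI)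
      fix k
      show "coeff (?p + smult (of_real r) ([:0, 1:] * pderiv ?p)) k
          = coeff (binomial_poly d (\<lambda>k. (1 + of_real (r * real k)) * w k)) k"
        by (cases k) (simp_all add: coeff_binomial_poly coeff_pderiv algebra_simps)
    qed
    finally show ?thesis .
  qed
  have "neg_real_rooted (binomial_poly d (\<lambda>k. (1 + of_real (s * real k)) * ((1 + of_real (- s * real k)) *
      ((1 - of_real ((s * real k)\<^sup>2)) ^ m * u k))))"
    by (intro step Suc) auto
  then show ?case
    by (simp add: algebra_simps power2_eq_square)
qed

text \<open>For \<open>Re z < 0\<close> the bound is \<open>\<bar>Im z\<bar> / \<bar>z\<bar>\<close>, because \<open>(1 + r * z) * cnj z\<close> has imaginary part
  \<open>- Im z\<close> for every real \<open>r\<close>.\<close>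

lemma slit_plane_norm_lower_bound:
  assumes "\<not> (z \<in> \<real> \<and> Re z < 0)"
  obtains \<delta> :: real where "0 < \<delta>" "\<delta> \<le> 1" "\<And>r. 0 \<le> r \<Longrightarrow> \<delta> \<le> cmod (1 + of_real r * z)"
proof (cases "0 \<le> Re z")
  case True
  have "1 \<le> cmod (1 + of_real r * z)" if "0 \<le> r" for r
    using complex_Re_le_cmod[of "1 + of_real r * z"] True that
    by (smt (verit) Re_complex_of_real complex_Re_numeral mult_nonneg_nonneg one_complex.sel(1) plus_complex.sel(1) scaleR_complex.sel(1) scaleR_conv_of_real)
  then show ?thesis
    using that[of 1] by simp
next
  case False
  then have Im: "Im z \<noteq> 0" and "z \<noteq> 0"
    using assms by (auto simp: complex_is_Real_iff)
  have "\<bar>Im z\<bar> / cmod z \<le> cmod (1 + of_real r * z)" for r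
  proof -
    have "Im ((1 + of_real r * z) * cnj z) = - Im z"
      by (simp add: algebra_simps)
    then have "\<bar>Im z\<bar> \<le> cmod ((1 + of_real r * z) * cnj z)"
      by (metis abs_Im_le_cmod abs_minus_cancel)
    then show ?thesis
      using \<open>z \<noteq> 0\<close> by (simp add: norm_mult divide_le_eq)
  qed
  then show ?thesis
    using that[of "\<bar>Im z\<bar> / cmod z"] Im \<open>z \<noteq> 0\<close> by (simp add: abs_Im_le_cmod)
qed

text \<open>The polynomial is a product of at most \<open>d\<close> factors \<open>1 + r * z\<close> with \<open>r > 0\<close>.  As the bound depends
  only on \<open>d\<close> and \<open>z\<close>, it survives limits of polynomials of bounded degree; this replaces an appeal
  to Hurwitz's theorem.\<close>

lemma neg_real_rooted_norm_lower_bound: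
  assumes p: "neg_real_rooted p" "poly p 0 = 1" "degree p \<le> d"
    and \<delta>: "0 < \<delta>" "\<delta> \<le> 1" "\<And>r. 0 \<le> r \<Longrightarrow> \<delta> \<le> cmod (1 + of_real r * z)"
  shows "\<delta> ^ d \<le> cmod (poly p z)"
proof -
  have "p \<noteq> 0"
    using p by (simp add: neg_real_rooted_def)
  then obtain A where A: "size A = degree p" "\<And>a. a \<in># A \<longleftrightarrow> poly p a = 0"
    "\<And>x. poly p x = lead_coeff p * (\<Prod>a\<in>#A. x - a)"
    using poly_roots_and_log_derivative by metis
  have neg: "Im a = 0 \<and> Re a < 0" if "a \<in># A" for a
    using that A(2) p(1) by (auto simp: neg_real_rooted_def complex_is_Real_iff)
  have "(\<forall>a\<in>#B. Im a = 0 \<and> Re a < 0) \<Longrightarrow>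
      \<delta> ^ size B * cmod (\<Prod>a\<in>#B. 0 - a) \<le> cmod (\<Prod>a\<in>#B. z - a)" for B
  proof (induction B)
    case (add b B)
    define \<beta> where "\<beta> = - Re b"
    have \<beta>: "0 < \<beta>" "b = - of_real \<beta>"
      using add.prems by (auto simp: complex_eq_iff \<beta>_def)
    then have "z - b = (1 + of_real (1 / \<beta>) * z) * (0 - b)"
      by (simp add: field_simps)
    moreover have "\<delta> \<le> cmod (1 + of_real (1 / \<beta>) * z)"
      using \<beta> by (intro \<delta>(3)) simp
    ultimately have "\<delta> * cmod (0 - b) \<le> cmod (z - b)"
      by (metis mult_right_mono norm_ge_zero norm_mult)
    then have "(\<delta> * cmod (0 - b)) * (\<delta> ^ size B * cmod (\<Prod>a\<in>#B. 0 - a)) \<le> cmod (z - b) * cmod (\<Prod>a\<in>#B. z - a)"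
      using add \<delta>(1) by (intro mult_mono) auto
    then show ?case
      by (simp add: norm_mult mult_ac)
  qed auto
  then have "cmod (lead_coeff p) * (\<delta> ^ size A * cmod (\<Prod>a\<in>#A. 0 - a)) \<le> cmod (lead_coeff p) * cmod (\<Prod>a\<in>#A. z - a)"
    using neg by (intro mult_left_mono) auto
  then have "\<delta> ^ size A * cmod (poly p 0) \<le> cmod (poly p z)"
    unfolding A(3) by (simp only: norm_mult mult_ac)
  moreover have "\<delta> ^ d \<le> \<delta> ^ size A"
    using \<delta> p(3) A(1) by (simp add: power_decreasing)
  ultimately show ?thesis
    using p(2) by simp
qed

lemma neg_real_rooted_binomial: "neg_real_rooted (binomial_poly d (\<lambda>_. 1))"
proof -
  have eq: "poly (binomial_poly d (\<lambda>_. 1)) z = (z + 1) ^ d" for z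
    by (simp add: poly_binomial_poly binomial_ring)
  then have "\<forall>z. poly (binomial_poly d (\<lambda>_. 1)) z = 0 \<longrightarrow> z = - 1"
    using eq by (auto simp: eq_neg_iff_add_eq_0)
  moreover have "binomial_poly d (\<lambda>_. 1) \<noteq> 0"
    using eq[of 0] by auto
  ultimately show ?thesis
    by (auto simp: neg_real_rooted_def)
qed

text \<open>The coefficients are the limits of \<open>(d choose k) * (1 - c * k\<^sup>2 / m) ^ m\<close>, whose polynomials have
  negative real roots once \<open>m > c * d\<^sup>2\<close>.\<close>

lemma gaussian_binomial_nonzero:
  assumes c: "0 \<le> c" and z: "\<not> (z \<in> \<real> \<and> Re z < 0)"
  shows "poly (binomial_poly d (\<lambda>k. of_real (exp (- c * (real k)\<^sup>2)))) z \<noteq> 0"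
proof -
  obtain \<delta> :: real where \<delta>: "0 < \<delta>" "\<delta> \<le> 1" "\<And>r. 0 \<le> r \<Longrightarrow> \<delta> \<le> cmod (1 + of_real r * z)"
    using slit_plane_norm_lower_bound[OF z] by metis
  define u where "u m k = complex_of_real ((1 + - c * (real k)\<^sup>2 / real m) ^ m)" for m k
  have lim: "(\<lambda>m. poly (binomial_poly d (u m)) z)
      \<longlonglongrightarrow> poly (binomial_poly d (\<lambda>k. of_real (exp (- c * (real k)\<^sup>2)))) z"
    unfolding poly_binomial_poly u_def
    by (intro tendsto_intros tendsto_exp_limit_sequentially)
  have "\<forall>\<^sub>F m in sequentially. c * (real d)\<^sup>2 < real m"
    using filterlim_real_sequentially by (simp add: filterlim_at_top_dense)
  then have "\<forall>\<^sub>F m in sequentially. \<delta> ^ d \<le> cmod (poly (binomial_poly d (u m)) z)"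
  proof eventually_elim
    case (elim m)
    have m: "0 < real m"
      using elim c by (smt (verit) mult_nonneg_nonneg zero_le_power2)
    \<comment> \<open>With this \<open>s\<close> the multiplier \<open>(1 - (s * k)\<^sup>2) ^ m\<close> is \<open>(1 - c * k\<^sup>2 / m) ^ m\<close>.\<close>
    define s where "s = sqrt (c / real m)"
    have s2: "(s * real k)\<^sup>2 = c * (real k)\<^sup>2 / real m" for k
      using c m by (simp add: s_def power_mult_distrib)
    have "(s * real d)\<^sup>2 < 1\<^sup>2"
      using elim m by (simp add: s2)
    then have "\<bar>s\<bar> * real d < 1"
      using abs_square_less_1[of "s * real d"] by (simp add: abs_mult)
    moreover have "u m = (\<lambda>k. (1 - of_real ((s * real k)\<^sup>2)) ^ m * 1)"
      by (simp add: fun_eq_iff u_def s2)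
    ultimately have "neg_real_rooted (binomial_poly d (u m))"
      using neg_real_rooted_binomial_poly_multiplier[OF neg_real_rooted_binomial] by metis
    moreover have "poly (binomial_poly d (u m)) 0 = 1"
      by (simp add: poly_0_coeff_0 coeff_binomial_poly u_def)
    ultimately show ?case
      using neg_real_rooted_norm_lower_bound[OF _ _ degree_binomial_poly_le] \<delta> by blast
  qed
  with tendsto_norm[OF lim]
  have "\<delta> ^ d \<le> cmod (poly (binomial_poly d (\<lambda>k. of_real (exp (- c * (real k)\<^sup>2)))) z)"
    by (intro tendsto_lowerbound) auto
  then show ?thesis
    using \<delta>(1) by (metis norm_zero not_le zero_less_power)
qed

section \<open>The Grace--Walsh--Szego theorem for the right half-plane\<close>

text \<open>The condition \<open>\<xi> * \<bar>w\<bar>\<^sup>2 < Re w\<close> describes a disc or a half-plane.  Replacing \<open>\<bar>w\<bar>\<^sup>2\<close> by its tangent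
  \<open>2 * Re (cnj v * w) - \<bar>v\<bar>\<^sup>2\<close> at \<open>v\<close> turns it into a condition that is affine in \<open>w\<close> and can be
  summed; taking \<open>v\<close> to be a mean of the summands expresses that the region is convex.\<close>

lemma sum_mset_half_plane:
  fixes f :: "'a \<Rightarrow> complex"
  assumes "A \<noteq> {#}" and "\<And>a. a \<in># A \<Longrightarrow> \<xi> * (cmod (f a))\<^sup>2 < Re (f a)" and "0 \<le> \<xi>"
  shows "\<xi> * (2 * Re (cnj v * (\<Sum>a\<in>#A. f a)) - real (size A) * (cmod v)\<^sup>2) < Re (\<Sum>a\<in>#A. f a)"
  using assms(1,2)
proof (induction A)
  case (add b A)
  have "0 \<le> (cmod (f b - v))\<^sup>2" by simp
  also have "(cmod (f b - v))\<^sup>2 = (cmod (f b))\<^sup>2 - 2 * Re (cnj v * f b) + (cmod v)\<^sup>2"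
    unfolding cmod_power2 by (simp add: power2_eq_square algebra_simps)
  finally have "\<xi> * (2 * Re (cnj v * f b) - (cmod v)\<^sup>2) \<le> \<xi> * (cmod (f b))\<^sup>2"
    using \<open>0 \<le> \<xi>\<close> by (intro mult_left_mono) auto
  also have "\<dots> < Re (f b)"
    using add.prems(2) by simp
  finally have b: "\<xi> * (2 * Re (cnj v * f b) - (cmod v)\<^sup>2) < Re (f b)" .
  show ?case
  proof (cases "A = {#}")
    case True
    then show ?thesis using b by simp
  next
    case False
    then show ?thesis
      using add.IH add.prems(2) b by (simp add: algebra_simps)
  qed
qed simp

lemma Re_inverse_gt:
  assumes "\<xi> < Re y"  "0 \<le> \<xi>"
  shows "\<xi> * (cmod (1 / y))\<^sup>2 < Re (1 / y)"
proof -
  have "y \<noteq> 0"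
    using assms by auto
  then have "\<xi> / (cmod y)\<^sup>2 < Re y / (cmod y)\<^sup>2"
    using assms by (intro divide_strict_right_mono) auto
  then show ?thesis
    by (simp add: Re_divide cmod_power2 norm_divide power_divide)
qed

text \<open>Laguerre's theorem on polar derivatives.  With \<open>L\<close> the logarithmic derivative of \<open>p\<close> at \<open>x\<close>,
  vanishing means \<open>(x - a) * L = d\<close>.  Every summand \<open>1 / (x - r)\<close> of \<open>L\<close> lies in the convex region
  \<open>Re x * \<bar>w\<bar>\<^sup>2 < Re w\<close>, since \<open>Re r < 0\<close>; hence so does \<open>L / d\<close>: if \<open>p\<close> has
  fewer than \<open>d\<close> roots, the mean also involves the boundary point \<open>0\<close>, which does no harm as long as
  there is one root.  Then \<open>x - a = d / L\<close> has real part greater than \<open>Re x\<close>, which contradicts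
  \<open>0 \<le> Re a\<close>.\<close>

lemma polar_derivative_nonzero:
  fixes p :: "complex poly"
  assumes nz: "\<And>x. 0 \<le> Re x \<Longrightarrow> poly p x \<noteq> 0" and d: "degree p \<le> d" "0 < d"
    and a: "0 \<le> Re a" and x: "0 \<le> Re x"
  shows "of_nat d * poly p x + (a - x) * poly (pderiv p) x \<noteq> 0"
proof
  assume eq: "of_nat d * poly p x + (a - x) * poly (pderiv p) x = 0"
  have "p \<noteq> 0"
    using nz[of 0] by auto
  then obtain A where A: "size A = degree p" "\<And>a. a \<in># A \<longleftrightarrow> poly p a = 0"
    "\<And>x. poly p x \<noteq> 0 \<Longrightarrow> poly (pderiv p) x = poly p x * (\<Sum>a\<in>#A. 1 / (x - a))"
    using poly_roots_and_log_derivative by metis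
  define L where "L = (\<Sum>a\<in>#A. 1 / (x - a))"
  have "poly p x * (of_nat d + (a - x) * L) = 0"
    using eq A(3)[OF nz[OF x]] by (simp add: L_def algebra_simps)
  then have L: "(x - a) * L = of_nat d"
    using nz[OF x] by (simp add: left_diff_distrib) (simp add: algebra_simps)
  then have "L \<noteq> 0"
    using d by auto
  then have "A \<noteq> {#}"
    by (auto simp: L_def)
  define \<xi> where "\<xi> = Re x"
  define v where "v = L / of_nat d"
  have "\<xi> * (cmod (1 / (x - r)))\<^sup>2 < Re (1 / (x - r))" if "r \<in># A" for r
  proof -
    have "Re r < 0"
      using that A(2) nz by force
    then show ?thesis
      using x by (intro Re_inverse_gt) (auto simp: \<xi>_def)
  qed
  from sum_mset_half_plane[OF \<open>A \<noteq> {#}\<close> this, where v = v]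
  have lt: "\<xi> * (2 * Re (cnj v * L) - real (size A) * (cmod v)\<^sup>2) < Re L"
    using x by (simp add: L_def \<xi>_def)
  have v1: "Re (cnj v * L) = (cmod L)\<^sup>2 / d"
    unfolding v_def cmod_power2 by (simp add: power2_eq_square add_divide_distrib)
  have "real (size A) * (cmod v)\<^sup>2 \<le> real d * (cmod v)\<^sup>2"
    using d A(1) by (intro mult_right_mono) auto
  also have "\<dots> = (cmod L)\<^sup>2 / d"
    using d by (simp add: v_def norm_divide power_divide power2_eq_square)
  finally have "\<xi> * ((cmod L)\<^sup>2 / d) \<le> \<xi> * (2 * Re (cnj v * L) - real (size A) * (cmod v)\<^sup>2)"
    using x unfolding v1 by (intro mult_left_mono) (auto simp: \<xi>_def)
  with lt have "\<xi> * ((cmod L)\<^sup>2 / d) < Re L"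
    by linarith
  then have "\<xi> * (cmod L)\<^sup>2 < d * Re L"
    using d by (simp add: field_simps)
  moreover have "d * Re L = Re (x - a) * (cmod L)\<^sup>2"
  proof -
    have "of_nat d * cnj L = (x - a) * (of_real (cmod L))\<^sup>2"
      unfolding L[symmetric] using complex_norm_square[of L] by (simp add: mult_ac)
    then have "of_real (real d) * cnj L = (x - a) * of_real ((cmod L)\<^sup>2)"
      by simp
    from arg_cong[OF this, of Re] show ?thesis
      by (simp del: of_real_power of_real_of_nat_eq)
  qed
  ultimately have "\<xi> * (cmod L)\<^sup>2 < Re (x - a) * (cmod L)\<^sup>2"
    by simp
  then show False
    using a \<open>L \<noteq> 0\<close> by (simp add: \<xi>_def)
qed

text \<open>In binomial coordinates, the polar derivative at \<open>a\<close> is the substitution of \<open>u k + a * u (k + 1)\<close>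
  for \<open>u k\<close>: this sets one variable of the symmetric multiaffine form to \<open>a\<close>.\<close>

lemma binomial_poly_polar_nonzero:
  assumes nz: "\<And>x. 0 \<le> Re x \<Longrightarrow> poly (binomial_poly (Suc d) u) x \<noteq> 0"
    and a: "0 \<le> Re a" and x: "0 \<le> Re x"
  shows "poly (binomial_poly d (\<lambda>k. u k + a * u (Suc k))) x \<noteq> 0"
proof -
  let ?p = "binomial_poly (Suc d) u"
  have "smult (of_nat (Suc d)) ?p + [:a, - 1:] * pderiv ?p
      = smult (of_nat (Suc d)) (binomial_poly d (\<lambda>k. u k + a * u (Suc k)))"
  proof (rule poly_eqI)
    fix k
    \<comment> \<open>The identities \<open>(k + 1) * C(d + 1, k + 1) = (d + 1) * C(d, k) = (d + 1 - k) * C(d + 1, k)\<close>.\<close>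
    have up: "of_nat (Suc k) * of_nat (Suc d choose Suc k) = (of_nat (Suc d) * of_nat (d choose k) :: complex)"
      using Suc_times_binomial[of k d] by (metis of_nat_mult)
    have "Suc d * (Suc d choose k) = k * (Suc d choose k) + Suc d * (d choose k)"
    proof (cases k)
      case (Suc j)
      then show ?thesis
        using Suc_times_binomial[of j d] by (simp add: algebra_simps)
    qed simp
    then have stay: "of_nat (Suc d) * of_nat (Suc d choose k)
        = (of_nat k * of_nat (Suc d choose k) + of_nat (Suc d) * of_nat (d choose k) :: complex)"
      by (metis of_nat_add of_nat_mult)
    have "coeff (smult (of_nat (Suc d)) ?p + [:a, - 1:] * pderiv ?p) k
        = (of_nat (Suc d) * of_nat (Suc d choose k)) * u k
          + a * (of_nat (Suc k) * of_nat (Suc d choose Suc k)) * u (Suc k)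
          - of_nat k * of_nat (Suc d choose k) * u k"
      by (cases k) (simp_all add: coeff_binomial_poly coeff_pderiv algebra_simps del: binomial_Suc_Suc of_nat_Suc)
    also have "\<dots> = of_nat (Suc d) * of_nat (d choose k) * (u k + a * u (Suc k))"
      unfolding stay up by (simp add: algebra_simps del: of_nat_Suc)
    finally show "coeff (smult (of_nat (Suc d)) ?p + [:a, - 1:] * pderiv ?p) k
        = coeff (smult (of_nat (Suc d)) (binomial_poly d (\<lambda>k. u k + a * u (Suc k)))) k"
      by (simp add: coeff_binomial_poly del: of_nat_Suc)
  qed
  from arg_cong[OF this, of "\<lambda>q. poly q x"]
  have eq: "of_nat (Suc d) * poly ?p x + (a - x) * poly (pderiv ?p) x
      = of_nat (Suc d) * poly (binomial_poly d (\<lambda>k. u k + a * u (Suc k))) x"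
    by (simp add: algebra_simps del: of_nat_Suc)
  have "of_nat (Suc d) * poly ?p x + (a - x) * poly (pderiv ?p) x \<noteq> 0"
    using nz a x by (intro polar_derivative_nonzero degree_binomial_poly_le) auto
  then show ?thesis
    unfolding eq by auto
qed

definition multiaffine :: "('h set \<Rightarrow> complex) \<Rightarrow> 'h set \<Rightarrow> ('h \<Rightarrow> complex) \<Rightarrow> complex" where
  "multiaffine c X s = (\<Sum>S\<in>Pow X. c S * (\<Prod>h\<in>S. s h))"

lemma multiaffine_cong:
  assumes "\<And>S. S \<subseteq> X \<Longrightarrow> c S = c' S" "\<And>h. h \<in> X \<Longrightarrow> s h = s' h"
  shows "multiaffine c X s = multiaffine c' X s'"
  unfolding multiaffine_def using assms by (intro sum.cong arg_cong2[of _ _ _ _ "(*)"] prod.cong) auto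

lemma sum_Pow_insert:
  fixes f :: "'a set \<Rightarrow> 'b::comm_monoid_add"
  assumes "finite X" "h \<notin> X"
  shows "(\<Sum>S\<in>Pow (insert h X). f S) = (\<Sum>S\<in>Pow X. f S) + (\<Sum>S\<in>Pow X. f (insert h S))"
proof -
  have "inj_on (insert h) (Pow X)"
    using assms(2) by (auto simp: inj_on_def) 
  moreover have "Pow X \<inter> insert h ` Pow X = {}"
    using assms(2) by auto
  ultimately show ?thesis
    using assms(1) by (simp add: Pow_insert sum.union_disjoint sum.reindex)
qed

lemma multiaffine_insert:
  assumes "finite X" "h \<notin> X"
  shows "multiaffine c (insert h X) s
    = multiaffine c X s + s h * multiaffine (\<lambda>S. c (insert h S)) X s"
proof -
  have "(\<Sum>S\<in>Pow X. c (insert h S) * (\<Prod>k\<in>insert h S. s k))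
      = s h * (\<Sum>S\<in>Pow X. c (insert h S) * (\<Prod>k\<in>S. s k))"
    unfolding sum_distrib_left
  proof (intro sum.cong refl)
    fix S assume "S \<in> Pow X"
    then have "finite S" "h \<notin> S"
      using assms by (auto intro: finite_subset)
    then show "c (insert h S) * (\<Prod>k\<in>insert h S. s k) = s h * (c (insert h S) * (\<Prod>k\<in>S. s k))"
      by simp
  qed
  then show ?thesis
    using assms by (simp add: multiaffine_def sum_Pow_insert)
qed

text \<open>A symmetric multiaffine polynomial is the polarisation of its restriction to equal variables.
  Fixing the variables one after the other, each step is a polar derivative of what remains.\<close>

lemma grace_walsh_szego_right_half_plane:
  assumes "finite X" and "\<And>x. 0 \<le> Re x \<Longrightarrow> poly (binomial_poly (card X) u) x \<noteq> 0"
    and "\<And>h. h \<in> X \<Longrightarrow> 0 \<le> Re (s h)"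
  shows "multiaffine (\<lambda>S. u (card S)) X s \<noteq> 0"
  using assms
proof (induction X arbitrary: u)
  case empty
  then show ?case
    using empty.prems(1)[of 0] by (simp add: multiaffine_def poly_binomial_poly)
next
  case (insert h X)
  have "multiaffine (\<lambda>S. u (card S)) (insert h X) s
      = multiaffine (\<lambda>S. u (card S)) X s + s h * multiaffine (\<lambda>S. u (card (insert h S))) X s"
    using insert.hyps by (rule multiaffine_insert)
  also have "multiaffine (\<lambda>S. u (card (insert h S))) X s = multiaffine (\<lambda>S. u (Suc (card S))) X s"
    using insert.hyps by (intro multiaffine_cong) (auto intro!: arg_cong[of _ _ u] card_insert_disjoint intro: finite_subset)
  also have "multiaffine (\<lambda>S. u (card S)) X s + s h * multiaffine (\<lambda>S. u (Suc (card S))) X s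
      = multiaffine (\<lambda>S. u (card S) + s h * u (Suc (card S))) X s"
    by (simp add: multiaffine_def sum_distrib_left sum.distrib[symmetric] algebra_simps)
  also have "\<dots> \<noteq> 0"
    using insert.prems insert.hyps by (intro insert.IH binomial_poly_polar_nonzero) auto
  finally show ?case .
qed

section \<open>Nonvanishing on half-planes\<close>

definition half_plane :: "complex \<Rightarrow> complex set" where
  "half_plane t = {t * s | s. 0 \<le> Re s}"

definition nonvanishing_on :: "complex set \<Rightarrow> ('h set \<Rightarrow> complex) \<Rightarrow> 'h set \<Rightarrow> bool" where
  "nonvanishing_on K c X \<longleftrightarrow> (\<forall>s. s ` X \<subseteq> K \<longrightarrow> multiaffine c X s \<noteq> 0)"

text \<open>With equal variables \<open>t * x\<close>, where \<open>0 \<le> Re x\<close>, this is the Gaussian binomial polynomial at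
  \<open>b ^ d * t * x\<close>, because \<open>b ^ (k * (d - k)) = b ^ (- k\<^sup>2) * (b ^ d) ^ k\<close>.  That point is not a
  negative real, since \<open>0 < Re t\<close>.\<close>

lemma nonvanishing_on_complete_graph:
  assumes b: "1 \<le> b" and t: "0 < Re t" and X: "finite X"
  shows "nonvanishing_on (half_plane t)
    (\<lambda>S. complex_of_real b ^ (card S * (card X - card S))) X"
  unfolding nonvanishing_on_def
proof (intro allI impI)
  fix s assume s: "s ` X \<subseteq> half_plane t"
  define d where "d = card X"
  define u where "u k = complex_of_real b ^ (k * (d - k))" for k
  define r where "r h = s h / t" for h
  have "t \<noteq> 0"
    using t by auto
  have "0 \<le> Re (r h)" and sr: "s h = t * r h" if "h \<in> X" for h
    using s that \<open>t \<noteq> 0\<close> by (auto simp: half_plane_def r_def image_subset_iff dest!: bspec)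
  moreover have "poly (binomial_poly (card X) (\<lambda>k. t ^ k * u k)) x \<noteq> 0" if x: "0 \<le> Re x" for x
  proof -
    have tx: "\<not> (of_real (b ^ d) * (t * x) \<in> \<real> \<and> Re (of_real (b ^ d) * (t * x)) < 0)"
    proof
      assume neg: "of_real (b ^ d) * (t * x) \<in> \<real> \<and> Re (of_real (b ^ d) * (t * x)) < 0"
      define y where "y = b ^ d * Re (t * x)"
      have y: "of_real (b ^ d) * (t * x) = of_real y" "y < 0"
        using neg by (simp_all add: y_def complex_eq_iff complex_is_Real_iff del: of_real_power)
      have "0 < b ^ d"
        using b by simp
      have "of_real (b ^ d) * (cmod t)\<^sup>2 * x = of_real y * cnj t"
        using complex_norm_square[of t] by (simp add: mult_ac flip: y(1))
      then have "of_real (b ^ d * (cmod t)\<^sup>2) * x = of_real y * cnj t"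
        by simp
      from arg_cong[OF this, of Re] have "b ^ d * (cmod t)\<^sup>2 * Re x = y * Re t"
        by (simp del: of_real_power of_real_mult)
      moreover have "0 \<le> b ^ d * (cmod t)\<^sup>2 * Re x"
        using x \<open>0 < b ^ d\<close> by simp
      ultimately show False
        using y(2) t by (smt (verit) mult_neg_pos)
    qed
    have gauss: "u k = of_real (exp (- ln b * (real k)\<^sup>2)) * of_real (b ^ d) ^ k" if "k \<le> d" for k
    proof -
      have "exp (ln b * real j) = b ^ j" for j
        using b by (metis exp_ln exp_of_nat_mult less_le_trans mult.commute zero_less_one)
      from this[of "k * k"] this[of "d * k"] this[of "k * (d - k)"]
      have e: "b ^ (k * k) = exp (ln b * (real k)\<^sup>2)" and "b ^ (d * k) = b ^ (k * (d - k)) * b ^ (k * k)"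
        using that by (auto simp: power2_eq_square algebra_simps simp flip: power_add)
      then have "b ^ (k * (d - k)) = exp (- ln b * (real k)\<^sup>2) * (b ^ d) ^ k"
        unfolding power_mult[symmetric] using e by (simp add: exp_minus field_simps)
      then show ?thesis
        unfolding u_def by (metis of_real_mult of_real_power)
    qed
    have "poly (binomial_poly (card X) (\<lambda>k. t ^ k * u k)) x
        = poly (binomial_poly d (\<lambda>k. of_real (exp (- ln b * (real k)\<^sup>2)))) (of_real (b ^ d) * (t * x))"
      unfolding poly_binomial_poly d_def[symmetric]
      by (intro sum.cong refl) (simp add: gauss power_mult_distrib mult_ac)
    then show ?thesis
      using gaussian_binomial_nonzero[OF _ tx, of "ln b"] b by simp
  qed
  ultimately have "multiaffine (\<lambda>S. t ^ card S * u (card S)) X r \<noteq> 0"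
    using X by (intro grace_walsh_szego_right_half_plane[where u = "\<lambda>k. t ^ k * u k"]) auto
  also have "multiaffine (\<lambda>S. t ^ card S * u (card S)) X r = multiaffine (\<lambda>S. u (card S)) X s"
    unfolding multiaffine_def
  proof (intro sum.cong refl)
    fix S assume "S \<in> Pow X"
    then have "(\<Prod>h\<in>S. s h) = (\<Prod>h\<in>S. t * r h)"
      using sr by (intro prod.cong) auto
    then show "t ^ card S * u (card S) * (\<Prod>h\<in>S. r h) = u (card S) * (\<Prod>h\<in>S. s h)"
      by (simp add: prod.distrib)
  qed
  finally show "multiaffine (\<lambda>S. complex_of_real b ^ (card S * (card X - card S))) X s \<noteq> 0"
    by (simp add: u_def d_def)
qed

text \<open>If \<open>\<alpha> + \<gamma> = 0\<close>, the two roots have product \<open>\<alpha> / \<gamma> = -1\<close>.  As \<open>-1 / y\<close> and \<open>y\<close> have real parts of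
  opposite sign, they cannot both lie in the open left half-plane.\<close>

lemma quadratic_root_pair:
  fixes \<alpha> \<beta> :: complex
  assumes "\<And>x. 0 \<le> Re x \<Longrightarrow> \<alpha> + \<beta> * x + \<gamma> * x\<^sup>2 \<noteq> 0"
  shows "\<alpha> + \<gamma> \<noteq> 0"
proof
  assume "\<alpha> + \<gamma> = 0"
  then have \<gamma>: "\<gamma> = - \<alpha>"
    by (simp add: eq_neg_iff_add_eq_0 add.commute)
  have "\<alpha> \<noteq> 0"
    using assms[of 0] by simp
  \<comment> \<open>The roots are given by the quadratic formula; \<open>w\<^sup>2\<close> is the discriminant for \<open>\<gamma> = - \<alpha>\<close>.\<close>
  define w where "w = csqrt (\<beta>\<^sup>2 + 4 * \<alpha>\<^sup>2)"
  define x where "x = (\<beta> + w) / (2 * \<alpha>)"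
  define y where "y = (\<beta> - w) / (2 * \<alpha>)"
  have w: "w\<^sup>2 = \<beta>\<^sup>2 + 4 * \<alpha>\<^sup>2"
    by (simp add: w_def)
  have x: "2 * \<alpha> * x = \<beta> + w" and y: "2 * \<alpha> * y = \<beta> - w"
    using \<open>\<alpha> \<noteq> 0\<close> by (simp_all add: x_def y_def)
  have neg: "Re v < 0" if "(2 * \<alpha> * v - \<beta>)\<^sup>2 = w\<^sup>2" for v
  proof (rule ccontr)
    have "4 * \<alpha> * (\<alpha> + \<beta> * v + \<gamma> * v\<^sup>2) = 4 * \<alpha>\<^sup>2 + \<beta>\<^sup>2 - (2 * \<alpha> * v - \<beta>)\<^sup>2"
      unfolding \<gamma> by (simp add: power2_eq_square algebra_simps)
    also have "\<dots> = 0"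
      using that w by simp
    finally have "\<alpha> + \<beta> * v + \<gamma> * v\<^sup>2 = 0"
      using \<open>\<alpha> \<noteq> 0\<close> by simp
    moreover assume "\<not> Re v < 0"
    ultimately show False
      using assms[of v] by simp
  qed
  have "Re x < 0" "Re y < 0"
    by (rule neg, simp add: x y)+
  have "4 * \<alpha>\<^sup>2 * (x * y) = (2 * \<alpha> * x) * (2 * \<alpha> * y)"
    by (simp add: power2_eq_square)
  also have "\<dots> = \<beta>\<^sup>2 - w\<^sup>2"
    unfolding x y by (simp add: power2_eq_square algebra_simps)
  also have "\<dots> = 4 * \<alpha>\<^sup>2 * (- 1)"
    unfolding w by simp
  finally have "4 * \<alpha>\<^sup>2 * (x * y) = 4 * \<alpha>\<^sup>2 * (- 1)" .
  moreover have "4 * \<alpha>\<^sup>2 \<noteq> 0"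
    using \<open>\<alpha> \<noteq> 0\<close> by simp
  ultimately have xy: "x * y = - 1"
    by (rule mult_left_cancel[THEN iffD1, rotated])
  have "x * (y * cnj y) = (x * y) * cnj y"
    by (simp only: mult.assoc)
  then have "x * (y * cnj y) = - cnj y"
    unfolding xy by simp
  then have "x * of_real ((cmod y)\<^sup>2) = - cnj y"
    by (simp only: complex_norm_square)
  from arg_cong[OF this, of Re] have "Re x * (cmod y)\<^sup>2 = - Re y"
    by (simp del: of_real_power)
  then show False
    using \<open>Re x < 0\<close> \<open>Re y < 0\<close> by (smt (verit) mult_nonpos_nonneg zero_le_power2)
qed

text \<open>An Asano contraction: put both variables equal to \<open>t * x\<close> and apply the previous lemma to the
  resulting quadratic polynomial in \<open>x\<close>.\<close>

lemma nonvanishing_on_contract: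
  assumes nv: "nonvanishing_on (half_plane t) c (insert h (insert h' X))"
    and X: "finite X" "h \<notin> X" "h' \<notin> X" "h \<noteq> h'"
  shows "nonvanishing_on (half_plane t) (\<lambda>S. c S + t\<^sup>2 * c (insert h (insert h' S))) X"
  unfolding nonvanishing_on_def
proof (intro allI impI)
  fix s assume s: "s ` X \<subseteq> half_plane t"
  define \<alpha> where "\<alpha> = multiaffine c X s"
  define \<beta> where "\<beta> = multiaffine (\<lambda>S. c (insert h S)) X s + multiaffine (\<lambda>S. c (insert h' S)) X s"
  define \<gamma> where "\<gamma> = multiaffine (\<lambda>S. c (insert h (insert h' S))) X s"
  have "\<alpha> + (t * \<beta>) * x + (t\<^sup>2 * \<gamma>) * x\<^sup>2 \<noteq> 0" if x: "0 \<le> Re x" for x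
  proof -
    define s' where "s' = s(h := t * x, h' := t * x)"
    have s's: "multiaffine c' X s' = multiaffine c' X s" for c'
      using X by (intro multiaffine_cong) (auto simp: s'_def)
    have "s' ` insert h (insert h' X) \<subseteq> half_plane t"
      using s x by (auto simp: s'_def half_plane_def)
    then have "multiaffine c (insert h (insert h' X)) s' \<noteq> 0"
      using nv by (simp add: nonvanishing_on_def)
    also have "multiaffine c (insert h (insert h' X)) s' = \<alpha> + (t * \<beta>) * x + (t\<^sup>2 * \<gamma>) * x\<^sup>2"
      using X by (simp add: multiaffine_insert s's \<alpha>_def \<beta>_def \<gamma>_def)
        (simp add: s'_def power2_eq_square algebra_simps)
    finally show ?thesis .
  qed
  then have "\<alpha> + t\<^sup>2 * \<gamma> \<noteq> 0"
    by (rule quadratic_root_pair)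
  also have "\<alpha> + t\<^sup>2 * \<gamma> = multiaffine (\<lambda>S. c S + t\<^sup>2 * c (insert h (insert h' S))) X s"
    by (simp add: \<alpha>_def \<gamma>_def multiaffine_def sum_distrib_left algebra_simps sum.distrib)
  finally show "multiaffine (\<lambda>S. c S + t\<^sup>2 * c (insert h (insert h' S))) X s \<noteq> 0" .
qed

text \<open>Contracting all pairs \<open>H e\<close> leaves no variables: only the selections of variables that are unions
  of pairs survive, and each selected pair contributes a factor \<open>t\<^sup>2\<close>.\<close>

lemma sum_contracted_nonzero:
  assumes "finite E" and "\<And>e. e \<in> E \<Longrightarrow> card (H e) = 2" and "disjoint_family_on H E"
    and "nonvanishing_on (half_plane t) c (\<Union>e\<in>E. H e)"
  shows "(\<Sum>F\<in>Pow E. (t\<^sup>2) ^ card F * c (\<Union>e\<in>F. H e)) \<noteq> 0"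
  using assms
proof (induction E arbitrary: c)
  case empty
  then show ?case
    by (simp add: nonvanishing_on_def multiaffine_def)
next
  case (insert e E)
  obtain h h' where h: "H e = {h, h'}" "h \<noteq> h'"
    using insert.prems(1)[OF insertI1] unfolding card_2_iff by blast
  let ?X = "\<Union>e\<in>E. H e"
  have fin: "finite (H f)" if "f \<in> E" for f
    using insert.prems(1)[of f] that by (intro card_ge_0_finite) simp
  have disj: "H e \<inter> H f = {}" if "f \<in> E" for f
    using disjoint_family_onD[OF insert.prems(2), of e f] insert.hyps that by auto
  have X: "finite ?X" "h \<notin> ?X" "h' \<notin> ?X"
    using insert.hyps(1) fin disj unfolding h(1) by auto
  define c' where "c' S = c S + t\<^sup>2 * c (insert h (insert h' S))" for S
  have "nonvanishing_on (half_plane t) c (insert h (insert h' ?X))"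
    using insert.prems(3) h by simp
  then have "nonvanishing_on (half_plane t) c' ?X"
    unfolding c'_def using X h(2) by (intro nonvanishing_on_contract)
  then have "(\<Sum>F\<in>Pow E. (t\<^sup>2) ^ card F * c' (\<Union>e\<in>F. H e)) \<noteq> 0"
  proof (rule insert.IH[rotated 2])
    show "card (H f) = 2" if "f \<in> E" for f
      using insert.prems(1) that by simp
    show "disjoint_family_on H E"
      by (rule disjoint_family_on_mono[OF subset_insertI insert.prems(2)])
  qed
  also have "(\<Sum>F\<in>Pow E. (t\<^sup>2) ^ card F * c' (\<Union>e\<in>F. H e))
      = (\<Sum>F\<in>Pow E. (t\<^sup>2) ^ card F * c (\<Union>e\<in>F. H e))
        + (\<Sum>F\<in>Pow E. (t\<^sup>2) ^ card (insert e F) * c (\<Union>e\<in>insert e F. H e))"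
    unfolding sum.distrib[symmetric]
  proof (intro sum.cong refl)
    fix F assume "F \<in> Pow E"
    then have "finite F" "e \<notin> F"
      using insert.hyps by (auto intro: finite_subset)
    then show "(t\<^sup>2) ^ card F * c' (\<Union>e\<in>F. H e) = (t\<^sup>2) ^ card F * c (\<Union>e\<in>F. H e)
        + (t\<^sup>2) ^ card (insert e F) * c (\<Union>e\<in>insert e F. H e)"
      by (simp add: c'_def h algebra_simps)
  qed
  finally show ?case
    using insert.hyps by (simp add: sum_Pow_insert)
qed

text \<open>Polynomials in disjoint sets of variables: the one with these coefficients is their product.\<close>

lemma nonvanishing_on_Un:
  assumes "finite X" "finite Y" "X \<inter> Y = {}"
    and "nonvanishing_on K c X" "nonvanishing_on K c' Y"
  shows "nonvanishing_on K (\<lambda>S. c (S \<inter> X) * c' (S \<inter> Y)) (X \<union> Y)"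
  unfolding nonvanishing_on_def
proof (intro allI impI)
  fix s assume s: "s ` (X \<union> Y) \<subseteq> K"
  have split: "(S \<union> T) \<inter> X = S" "(S \<union> T) \<inter> Y = T" if "S \<subseteq> X" "T \<subseteq> Y" for S T
    using that assms(3) by blast+
  have bij: "bij_betw (\<lambda>(S, T). S \<union> T) (Pow X \<times> Pow Y) (Pow (X \<union> Y))"
  proof (rule bij_betw_byWitness[where f' = "\<lambda>U. (U \<inter> X, U \<inter> Y)"])
    show "\<forall>P\<in>Pow X \<times> Pow Y. ((case P of (S, T) \<Rightarrow> S \<union> T) \<inter> X, (case P of (S, T) \<Rightarrow> S \<union> T) \<inter> Y) = P"
      by (simp add: split split_paired_all)
  qed blast+
  have "multiaffine (\<lambda>S. c (S \<inter> X) * c' (S \<inter> Y)) (X \<union> Y) s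
      = (\<Sum>(S, T)\<in>Pow X \<times> Pow Y. (c S * (\<Prod>h\<in>S. s h)) * (c' T * (\<Prod>h\<in>T. s h)))"
    unfolding multiaffine_def
  proof (subst sum.reindex_bij_betw[OF bij, symmetric], intro sum.cong refl, clarsimp)
    fix S T assume ST: "S \<subseteq> X" "T \<subseteq> Y"
    moreover have "S \<inter> T = {}"
      using ST assms(3) by blast
    moreover have "finite S" "finite T"
      using ST assms(1,2) finite_subset by blast+
    ultimately show "c ((S \<union> T) \<inter> X) * c' ((S \<union> T) \<inter> Y) * (\<Prod>h\<in>S \<union> T. s h)
        = c S * (\<Prod>h\<in>S. s h) * (c' T * (\<Prod>h\<in>T. s h))"
      by (simp add: split prod.union_disjoint)
  qed
  also have "\<dots> = multiaffine c X s * multiaffine c' Y s"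
    by (simp add: multiaffine_def sum_product sum.cartesian_product)
  also have "\<dots> \<noteq> 0"
    using assms(4,5) s by (auto simp: nonvanishing_on_def image_Un)
  finally show "multiaffine (\<lambda>S. c (S \<inter> X) * c' (S \<inter> Y)) (X \<union> Y) s \<noteq> 0" .
qed

lemma nonvanishing_on_UN:
  assumes "finite V" and "\<And>v. v \<in> V \<Longrightarrow> finite (X v)" and "disjoint_family_on X V"
    and "\<And>v. v \<in> V \<Longrightarrow> nonvanishing_on K (c v) (X v)"
  shows "nonvanishing_on K (\<lambda>S. \<Prod>v\<in>V. c v (S \<inter> X v)) (\<Union>v\<in>V. X v)"
  using assms
proof (induction V)
  case empty
  then show ?case
    by (simp add: nonvanishing_on_def multiaffine_def)
next
  case (insert v V)
  let ?Y = "\<Union>v\<in>V. X v"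
  have disj: "X v \<inter> ?Y = {}"
    using insert.prems(2) insert.hyps by (auto simp: disjoint_family_on_def)
  have "nonvanishing_on K (\<lambda>S. c v (S \<inter> X v) * (\<Prod>w\<in>V. c w ((S \<inter> ?Y) \<inter> X w))) (X v \<union> ?Y)"
    using insert.prems insert.hyps disj
    by (intro nonvanishing_on_Un insert.IH) (auto simp: disjoint_family_on_def)
  moreover have "(S \<inter> ?Y) \<inter> X w = S \<inter> X w" if "w \<in> V" for S w
    using that by auto
  ultimately show ?case
    using insert.hyps by simp
qed

section \<open>Line graphs\<close>

lemma (in finite_simple_graph) finite_edges: "finite (sg_edges G)"
proof (rule finite_subset)
  show "sg_edges G \<subseteq> Pow (sg_verts G)"
    using edge_subset by blast
qed (simp add: finite_verts)

lemma (in finite_simple_graph) card_inter_edges: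
  assumes "e \<in> sg_edges G" "f \<in> sg_edges G" "e \<noteq> f"
  shows "card (e \<inter> f) = (if e \<inter> f = {} then 0 else 1)"
proof -
  have fin: "finite e" "finite f"
    using edge_card[OF assms(1)] edge_card[OF assms(2)] by (auto intro: card_ge_0_finite)
  have "card (e \<inter> f) \<noteq> 2"
    using assms fin edge_card by (metis card_subset_eq inf_le1 inf_le2)
  moreover have "card (e \<inter> f) \<le> 2"
    using card_mono[of e "e \<inter> f"] edge_card[OF assms(1)] fin by simp
  moreover have "card (e \<inter> f) = 0 \<longleftrightarrow> e \<inter> f = {}"
    using fin by simp
  ultimately show ?thesis
    by auto
qed

text \<open>The boundary consists of the pairs \<open>(e, f)\<close> with \<open>e \<in> U\<close>, \<open>f \<notin> U\<close> and a common vertex.  The common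
  vertex is unique, so the pairs can be counted vertex by vertex.\<close>

lemma (in finite_simple_graph) card_edge_boundary_line_graph:
  assumes U: "U \<subseteq> sg_edges G"
  shows "card (edge_boundary (line_graph G) U)
    = (\<Sum>v\<in>sg_verts G. card {e \<in> U. v \<in> e} * card {e \<in> sg_edges G - U. v \<in> e})"
proof -
  let ?E = "sg_edges G"
  let ?P = "{(e, f) \<in> U \<times> (?E - U). e \<inter> f \<noteq> {}}"
  have finU: "finite U"
    using U finite_edges by (rule finite_subset)
  have "edge_boundary (line_graph G) U = (\<lambda>(e, f). {e, f}) ` ?P"
    using U by (fastforce simp: edge_boundary_def line_graph_def doubleton_eq_iff image_iff)
  moreover have "inj_on (\<lambda>(e, f). {e, f}) ?P"
    by (auto simp: inj_on_def doubleton_eq_iff)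
  ultimately have "card (edge_boundary (line_graph G) U) = card ?P"
    by (simp add: card_image)
  also have "\<dots> = (\<Sum>(e, f)\<in>U \<times> (?E - U). if e \<inter> f \<noteq> {} then 1 else 0)"
  proof -
    have "?P = {x \<in> U \<times> (?E - U). fst x \<inter> snd x \<noteq> {}}"
      by auto
    then show ?thesis
      using finU finite_edges
      by (simp only: card_eq_sum split_def sum.inter_filter finite_cartesian_product finite_Diff)
  qed
  also have "\<dots> = (\<Sum>(e, f)\<in>U \<times> (?E - U). card (e \<inter> f))"
  proof (intro sum.cong refl, clarify)
    fix e f assume "e \<in> U" "f \<in> ?E" "f \<notin> U"
    then have "e \<in> ?E" "e \<noteq> f"
      using U by auto
    then show "(if e \<inter> f \<noteq> {} then 1 else 0) = card (e \<inter> f)"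
      using card_inter_edges[of e f] \<open>f \<in> ?E\<close> by simp
  qed
  also have "\<dots> = (\<Sum>(e, f)\<in>U \<times> (?E - U). \<Sum>v\<in>sg_verts G. if v \<in> e \<and> v \<in> f then 1 else 0)"
  proof (intro sum.cong refl, clarify)
    fix e f assume "e \<in> U" "f \<in> ?E"
    then have "e \<inter> f = {v \<in> sg_verts G. v \<in> e \<and> v \<in> f}"
      using U edge_subset by blast
    then show "card (e \<inter> f) = (\<Sum>v\<in>sg_verts G. if v \<in> e \<and> v \<in> f then 1 else 0)"
      using finite_verts by (simp only: card_eq_sum sum.inter_filter)
  qed
  also have "\<dots> = (\<Sum>v\<in>sg_verts G. \<Sum>(e, f)\<in>U \<times> (?E - U). if v \<in> e \<and> v \<in> f then 1 else 0)"
    unfolding split_def by (rule sum.swap)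
  also have "\<dots> = (\<Sum>v\<in>sg_verts G. card {e \<in> U. v \<in> e} * card {e \<in> ?E - U. v \<in> e})"
  proof (intro sum.cong refl)
    fix v
    have "(\<Sum>(e, f)\<in>U \<times> (?E - U). if v \<in> e \<and> v \<in> f then 1 else 0)
        = card {x \<in> U \<times> (?E - U). v \<in> fst x \<and> v \<in> snd x}"
      using finU finite_edges
      by (simp only: card_eq_sum split_def sum.inter_filter finite_cartesian_product finite_Diff)
    also have "{x \<in> U \<times> (?E - U). v \<in> fst x \<and> v \<in> snd x} = {e \<in> U. v \<in> e} \<times> {e \<in> ?E - U. v \<in> e}"
      by auto
    finally show "(\<Sum>(e, f)\<in>U \<times> (?E - U). if v \<in> e \<and> v \<in> f then 1 else 0)
        = card {e \<in> U. v \<in> e} * card {e \<in> ?E - U. v \<in> e}"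
      by (simp add: card_cartesian_product)
  qed
  finally show ?thesis .
qed

theorem theorem1p1:
  fixes G :: "'a sgraph" and b :: real and z :: complex
  assumes "finite_simple_graph G"
    and "b \<ge> 1"
    and "ising_Z (line_graph G) z (complex_of_real b) = 0"
  shows "z \<in> \<real> \<and> Re z < 0"
proof (rule ccontr)
  assume z: "\<not> (z \<in> \<real> \<and> Re z < 0)"
  interpret finite_simple_graph G by fact
  let ?V = "sg_verts G" and ?E = "sg_edges G"
  have Z: "ising_Z (line_graph G) z b
      = (\<Sum>U\<in>Pow ?E. z ^ card U * complex_of_real b ^ card (edge_boundary (line_graph G) U))"
    by (simp add: ising_Z_def line_graph_def)
  show False
  proof (cases "z = 0")
    case True
    have "z ^ card U = (if U = {} then 1 else 0)" if "U \<in> Pow ?E" for U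
      using that True finite_edges by (auto simp: power_0_left card_eq_0_iff dest: finite_subset)
    then have "ising_Z (line_graph G) z b
        = (\<Sum>U\<in>Pow ?E. if U = {} then complex_of_real b ^ card (edge_boundary (line_graph G) {}) else 0)"
      unfolding Z by (intro sum.cong) auto
    also have "\<dots> = complex_of_real b ^ card (edge_boundary (line_graph G) {})"
      using finite_edges by simp
    finally show False
      using assms by simp
  next
    case False
    define t where "t = csqrt z"
    have t2: "t\<^sup>2 = z"
      by (simp add: t_def)
    \<comment> \<open>The principal square root has nonnegative real part, and squares of imaginary numbers are not positive.\<close>
    have "0 < Re t"
    proof (rule ccontr)
      assume "\<not> 0 < Re t"
      then have "Re t = 0"
        using csqrt_principal[of z] by (auto simp: t_def)
      then have "t\<^sup>2 = of_real (- ((Im t)\<^sup>2))" "Im t \<noteq> 0"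
        using False t2 by (auto simp: complex_eq_iff power2_eq_square)
      then show False
        using z t2 by (metis Re_complex_of_real Reals_of_real neg_less_0_iff_less zero_less_power2)
    qed
    \<comment> \<open>A half-edge is a pair of a vertex and an edge at it; \<open>H e\<close> and \<open>X v\<close> collect those of \<open>e\<close> and at \<open>v\<close>.\<close>
    define H where "H e = (\<lambda>v. (v, e)) ` e" for e :: "'a set"
    define X where "X v = Pair v ` {e \<in> ?E. v \<in> e}" for v
    define c where "c v S = complex_of_real b ^ (card S * (card (X v) - card S))" for v and S :: "('a \<times> 'a set) set"
    have card_H: "card (H e) = 2" if "e \<in> ?E" for e
      using edge_card[OF that] by (simp add: H_def card_image inj_on_def)
    have UN: "(\<Union>v\<in>?V. X v) = (\<Union>e\<in>?E. H e)"
      using edge_subset by (auto simp: X_def H_def)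
    have "nonvanishing_on (half_plane t) (\<lambda>S. \<Prod>v\<in>?V. c v (S \<inter> X v)) (\<Union>v\<in>?V. X v)"
    proof (intro nonvanishing_on_UN finite_verts)
      show "finite (X v)" for v
        using finite_edges by (simp add: X_def)
      then show "nonvanishing_on (half_plane t) (c v) (X v)" for v
        unfolding c_def using assms(2) \<open>0 < Re t\<close> by (intro nonvanishing_on_complete_graph)
      show "disjoint_family_on X ?V"
        by (auto simp: disjoint_family_on_def X_def)
    qed
    then have "(\<Sum>F\<in>Pow ?E. (t\<^sup>2) ^ card F * (\<Prod>v\<in>?V. c v ((\<Union>e\<in>F. H e) \<inter> X v))) \<noteq> 0"
      unfolding UN using finite_edges card_H
      by (intro sum_contracted_nonzero) (auto simp: disjoint_family_on_def H_def)
    also have "(\<Sum>F\<in>Pow ?E. (t\<^sup>2) ^ card F * (\<Prod>v\<in>?V. c v ((\<Union>e\<in>F. H e) \<inter> X v)))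
        = ising_Z (line_graph G) z b"
      unfolding Z t2
    proof (intro sum.cong refl arg_cong2[of _ _ _ _ "(*)"])
      fix F assume "F \<in> Pow ?E"
      then have F: "F \<subseteq> ?E" by simp
      have "c v ((\<Union>e\<in>F. H e) \<inter> X v)
          = complex_of_real b ^ (card {e \<in> F. v \<in> e} * card {e \<in> ?E - F. v \<in> e})" for v
      proof -
        have "(\<Union>e\<in>F. H e) \<inter> X v = Pair v ` {e \<in> F. v \<in> e}"
          using F by (auto simp: H_def X_def)
        then have "card ((\<Union>e\<in>F. H e) \<inter> X v) = card {e \<in> F. v \<in> e}"
          by (simp add: card_image inj_on_def)
        moreover have "card (X v) - card {e \<in> F. v \<in> e} = card {e \<in> ?E - F. v \<in> e}"
        proof -
          have "card (X v) = card {e \<in> ?E. v \<in> e}"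
            by (simp add: X_def card_image inj_on_def)
          moreover have "{e \<in> ?E - F. v \<in> e} = {e \<in> ?E. v \<in> e} - {e \<in> F. v \<in> e}"
            by auto
          moreover have "{e \<in> F. v \<in> e} \<subseteq> {e \<in> ?E. v \<in> e}" "finite {e \<in> F. v \<in> e}"
            using F finite_edges by (auto intro: finite_subset)
          ultimately show ?thesis
            by (simp add: card_Diff_subset)
        qed
        ultimately show ?thesis
          by (simp add: c_def)
      qed
      then show "(\<Prod>v\<in>?V. c v ((\<Union>e\<in>F. H e) \<inter> X v))
          = complex_of_real b ^ card (edge_boundary (line_graph G) F)"
        by (simp add: card_edge_boundary_line_graph[OF F] power_sum)
    qed
    finally show False
      using assms(3) by simp
  qed
qed

end
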